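(* Let $\mathcal{P}$ be a hereditary abstract $n$-polytope all of whose facets are chiral. Then either $\mathcal{P}$ is a $2$-orbit polytope which is chiral or belongs to the class $2_{\{n-1\}}$ (and hence all facets of $\mathcal{P}$ are isomorphic), or $\mathcal{P}$ is a $4$-orbit polytope.
   Context: An abstract $n$-polytope is a partially ordered set $\mathcal{P}$ with a strictly monotone rank function onto $\{-1,0,\ldots,n\}$, with a least face $F_{-1}$ and a greatest face $F_n$, in which every flag (maximal chain) has exactly $n+2$ elements, which is strongly flag-connected, and which satisfies the diamond condition. Facets are the $(n-1)$-faces, identified with sections $F/F_{-1}$. $\Gamma(\mathcal{P})$ is the automorphism group. For a flag $\Phi$ and $0\le i\le n-1$, $\Phi^i$ denotes the unique flag differing from $\Phi$ exactly in its $i$-face. A polytope is a $k$-orbit polytope if its automorphism group has exactly $k$ orbits on flags; it is chiral if it is a $2$-orbit polytope in which adjacent flags always lie in different orbits. A $2$-orbit polytope is in class $2_I$ if for every flag $\Phi$, $\Phi$ and $\Phi^i$ lie in the same orbit exactly when $i\in I$. $\mathcal{P}$ is hereditary if for every facet $F$, every automorphism of $F/F_{-1}$ extends to an automorphism of $\mathcal{P}$ (which then fixes $F$). *)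

theory Defs
  imports Main
begin

record 'a ranked_poset =
  faces :: "'a set"
  leq :: "'a rel"
  rank :: "'a \<Rightarrow> int"

definition face_less :: "'a ranked_poset \<Rightarrow> 'a \<Rightarrow> 'a \<Rightarrow> bool" where
  "face_less P F G \<longleftrightarrow> (F, G) \<in> leq P \<and> F \<noteq> G"

definition is_least_face :: "'a ranked_poset \<Rightarrow> 'a \<Rightarrow> bool" where
  "is_least_face P F \<longleftrightarrow> F \<in> faces P \<and> (\<forall>G \<in> faces P. (F, G) \<in> leq P)"

definition is_greatest_face :: "'a ranked_poset \<Rightarrow> 'a \<Rightarrow> bool" where
  "is_greatest_face P F \<longleftrightarrow> F \<in> faces P \<and> (\<forall>G \<in> faces P. (G, F) \<in> leq P)"

definition least_face :: "'a ranked_poset \<Rightarrow> 'a" where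
  "least_face P = (THE F. is_least_face P F)"

definition flags :: "'a ranked_poset \<Rightarrow> 'a set set" where
  "flags P = {\<Phi>. pred_on.maxchain (faces P) (face_less P) \<Phi>}"

definition adjacent :: "'a set \<Rightarrow> 'a set \<Rightarrow> bool" where
  "adjacent \<Phi> \<Psi> \<longleftrightarrow> card (\<Phi> - \<Psi>) = 1 \<and> card (\<Psi> - \<Phi>) = 1"

text \<open>Any two flags can be joined by a sequence of successively adjacent flags,
  each of which contains the intersection of the two.\<close>

definition strongly_flag_connected :: "'a ranked_poset \<Rightarrow> bool" where
  "strongly_flag_connected P \<longleftrightarrow>
    (\<forall>\<Phi> \<in> flags P. \<forall>\<Psi> \<in> flags P.
      (\<Phi>, \<Psi>) \<in> {(A, B). A \<in> flags P \<and> B \<in> flags P \<and> adjacent A B \<and>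
                          \<Phi> \<inter> \<Psi> \<subseteq> A \<and> \<Phi> \<inter> \<Psi> \<subseteq> B}\<^sup>*)"

definition diamond_condition :: "'a ranked_poset \<Rightarrow> bool" where
  "diamond_condition P \<longleftrightarrow>
    (\<forall>F \<in> faces P. \<forall>G \<in> faces P. face_less P F G \<and> rank P G - rank P F = 2 \<longrightarrow>
      card {H \<in> faces P. face_less P F H \<and> face_less P H G} = 2)"

text \<open>In a polytope the rank function is determined by the order, so carrying it along as
  data is no additional structure. The cardinality condition forces flags to be finite,
  since \<open>n + 2 \<ge> 1\<close>.\<close>

locale abstract_polytope =
  fixes P :: "'a ranked_poset" and n :: int
  assumes partial_order: "partial_order_on (faces P) (leq P)"
    and rank_strict_mono: "face_less P F G \<Longrightarrow> rank P F < rank P G"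
    and rank_onto: "rank P ` faces P = {-1..n}"
    and least: "\<exists>F. is_least_face P F"
    and greatest: "\<exists>F. is_greatest_face P F"
    and card_flag: "\<Phi> \<in> flags P \<Longrightarrow> int (card \<Phi>) = n + 2"
    and connected: "strongly_flag_connected P"
    and diamond: "diamond_condition P"

text \<open>The section \<open>F/G\<close>. The shift makes its ranks start at \<open>-1\<close>.\<close>

definition face_section :: "'a ranked_poset \<Rightarrow> 'a \<Rightarrow> 'a \<Rightarrow> 'a ranked_poset" where
  "face_section P F G =
    (let S = {H \<in> faces P. (G, H) \<in> leq P \<and> (H, F) \<in> leq P}
     in \<lparr>faces = S, leq = Restr (leq P) S, rank = (\<lambda>H. rank P H - rank P G - 1)\<rparr>)"

definition facets :: "'a ranked_poset \<Rightarrow> int \<Rightarrow> 'a set" where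
  "facets P n = {F \<in> faces P. rank P F = n - 1}"

abbreviation facet_section :: "'a ranked_poset \<Rightarrow> 'a \<Rightarrow> 'a ranked_poset" where
  "facet_section P F \<equiv> face_section P F (least_face P)"

definition isomorphisms :: "'a ranked_poset \<Rightarrow> 'b ranked_poset \<Rightarrow> ('a \<Rightarrow> 'b) set" where
  "isomorphisms P Q = {f. bij_betw f (faces P) (faces Q) \<and>
    (\<forall>F \<in> faces P. \<forall>G \<in> faces P. (F, G) \<in> leq P \<longleftrightarrow> (f F, f G) \<in> leq Q)}"

definition isomorphic :: "'a ranked_poset \<Rightarrow> 'b ranked_poset \<Rightarrow> bool" where
  "isomorphic P Q \<longleftrightarrow> isomorphisms P Q \<noteq> {}"

text \<open>The elements of the automorphism group \<open>\<Gamma>(P)\<close>; only their values on the faces matter.\<close>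

definition automorphisms :: "'a ranked_poset \<Rightarrow> ('a \<Rightarrow> 'a) set" where
  "automorphisms P = isomorphisms P P"

definition same_orbit :: "'a ranked_poset \<Rightarrow> 'a set \<Rightarrow> 'a set \<Rightarrow> bool" where
  "same_orbit P \<Phi> \<Psi> \<longleftrightarrow> (\<exists>f \<in> automorphisms P. \<Psi> = f ` \<Phi>)"

definition flag_orbits :: "'a ranked_poset \<Rightarrow> 'a set set set" where
  "flag_orbits P = flags P // {(\<Phi>, \<Psi>). \<Phi> \<in> flags P \<and> \<Psi> \<in> flags P \<and> same_orbit P \<Phi> \<Psi>}"

definition k_orbit_polytope :: "nat \<Rightarrow> 'a ranked_poset \<Rightarrow> int \<Rightarrow> bool" where
  "k_orbit_polytope k P n \<longleftrightarrow>
    abstract_polytope P n \<and> finite (flag_orbits P) \<and> card (flag_orbits P) = k"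

text \<open>The flag \<open>\<Phi>\<^sup>i\<close>, for \<open>0 \<le> i \<le> n - 1\<close>.\<close>

definition flag_adj :: "'a ranked_poset \<Rightarrow> int \<Rightarrow> 'a set \<Rightarrow> 'a set" where
  "flag_adj P i \<Phi> = (THE \<Psi>. \<Psi> \<in> flags P \<and> \<Psi> \<noteq> \<Phi> \<and>
    {F \<in> \<Psi>. rank P F \<noteq> i} = {F \<in> \<Phi>. rank P F \<noteq> i})"

lemma (in abstract_polytope) flag_adj_ex1:
  assumes \<Phi>: "\<Phi> \<in> flags P" and i: "0 \<le> i" "i \<le> n - 1"
  shows "\<exists>!\<Psi>. \<Psi> \<in> flags P \<and> \<Psi> \<noteq> \<Phi> \<and> {F \<in> \<Psi>. rank P F \<noteq> i} = {F \<in> \<Phi>. rank P F \<noteq> i}"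
proof -
  interpret pred_on "faces P" "face_less P" .
  have flag_iff: "X \<in> flags P \<longleftrightarrow> maxchain X" for X
    by (simp add: flags_def)
  have ch_sub: "X \<subseteq> faces P" if "chain X" for X
    using that by (simp add: chain_def)
  have cmp: "rank P x < rank P y \<Longrightarrow> face_less P x y" "rank P x = rank P y \<Longrightarrow> x = y"
    if "chain X" "x \<in> X" "y \<in> X" for X x y
    using chain_total[OF that] rank_strict_mono[of x y] rank_strict_mono[of y x] by auto
  have inj: "inj_on (rank P) X" if "chain X" for X
    using cmp(2)[OF that] by (auto simp: inj_on_def)
  have rg: "rank P ` X \<subseteq> {-1..n}" if "chain X" for X
    using ch_sub[OF that] rank_onto by blast
  have fin: "finite X" and le: "int (card X) \<le> n + 2" if "chain X" for X
  proof -
    show "finite X"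
      using finite_imageD[OF finite_subset[OF rg[OF that]] inj[OF that]] by simp
    have "card X = card (rank P ` X)" using inj[OF that] by (simp add: card_image)
    also have "\<dots> \<le> card {-1..n}" using rg[OF that] by (intro card_mono) auto
    finally show "int (card X) \<le> n + 2" using i by simp
  qed
  have full: "rank P ` X = {-1..n}" if "X \<in> flags P" for X
  proof (rule card_subset_eq)
    have c: "chain X" using that by (simp add: flag_iff maxchain_def)
    show "rank P ` X \<subseteq> {-1..n}" using rg[OF c] .
    show "card (rank P ` X) = card {-1..n}"
      using card_flag[OF that] inj[OF c] by (simp add: card_image)
  qed simp
  have c\<Phi>: "chain \<Phi>" using \<Phi> by (simp add: flag_iff maxchain_def)
  have "i \<in> rank P ` \<Phi>" "i - 1 \<in> rank P ` \<Phi>" "i + 1 \<in> rank P ` \<Phi>"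
    using full[OF \<Phi>] i by auto
  then obtain F A B where F: "F \<in> \<Phi>" "rank P F = i" and A: "A \<in> \<Phi>" "rank P A = i - 1"
    and B: "B \<in> \<Phi>" "rank P B = i + 1" by (auto elim!: imageE)
  let ?M = "{H \<in> faces P. face_less P A H \<and> face_less P H B}"
  have "face_less P A B" using cmp(1)[OF c\<Phi> A(1) B(1)] A B by simp
  then have "card ?M = 2"
    using diamond[unfolded diamond_condition_def, rule_format, of A B] A B ch_sub[OF c\<Phi>]
    by (simp add: subset_iff)
  moreover have FM: "F \<in> ?M"
    using cmp(1)[OF c\<Phi> A(1) F(1)] cmp(1)[OF c\<Phi> F(1) B(1)] A B F ch_sub[OF c\<Phi>] by auto
  ultimately obtain H where H: "?M = {F, H}" "H \<noteq> F"
  proof -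
    assume M: "card ?M = 2" "F \<in> ?M"
      and *: "\<And>H. ?M = {F, H} \<Longrightarrow> H \<noteq> F \<Longrightarrow> thesis"
    obtain x y where xy: "?M = {x, y}" "x \<noteq> y" using M(1) by (meson card_2_iff)
    show thesis
    proof (cases "F = x")
      case True
      then show ?thesis using *[of y] xy by simp
    next
      case False
      then have "F = y" using M(2) unfolding xy(1) by simp
      then show ?thesis using *[of x] xy by (simp add: insert_commute)
    qed
  qed
  have HM: "H \<in> faces P" "face_less P A H" "face_less P H B"
  proof -
    have "H \<in> ?M" unfolding H(1) by simp
    then show "H \<in> faces P" "face_less P A H" "face_less P H B" by simp_all
  qed
  have rH: "rank P H = i"
    using rank_strict_mono[OF HM(2)] rank_strict_mono[OF HM(3)] A B by simp
  have tr: "face_less P x z" if "face_less P x y" "face_less P y z" for x y z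
  proof -
    have "(x, z) \<in> leq P"
      using that partial_order unfolding partial_order_on_def preorder_on_def face_less_def
      by (blast dest: transD)
    moreover have "x \<noteq> z" using rank_strict_mono[OF that(1)] rank_strict_mono[OF that(2)] by auto
    ultimately show ?thesis by (simp add: face_less_def)
  qed
  let ?\<Psi> = "insert H (\<Phi> - {F})"
  have HX: "face_less P x H \<or> face_less P H x" if x: "x \<in> \<Phi>" "x \<noteq> F" for x
  proof -
    have "rank P x \<noteq> i" using cmp(2)[OF c\<Phi> x(1) F(1)] F x by auto
    then consider "x = A" | "x = B" | "rank P x < i - 1" | "i + 1 < rank P x"
      using cmp(2)[OF c\<Phi> x(1) A(1)] cmp(2)[OF c\<Phi> x(1) B(1)] A B by linarith
    then show ?thesis
    proof cases
      case 3
      then have "face_less P x A" using cmp(1)[OF c\<Phi> x(1) A(1)] A by simp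
      then show ?thesis using tr HM by blast
    next
      case 4
      then have "face_less P B x" using cmp(1)[OF c\<Phi> B(1) x(1)] B by simp
      then show ?thesis using tr HM by blast
    qed (use HM in auto)
  qed
  have c\<Psi>: "chain ?\<Psi>"
    unfolding chain_def using HX c\<Phi> HM(1) by (auto simp: chain_def)
  have Hn: "H \<notin> \<Phi>" using cmp(2)[OF c\<Phi> _ F(1), of H] H(2) rH F by auto
  have cardPsi: "int (card ?\<Psi>) = n + 2"
    using card_flag[OF \<Phi>] fin[OF c\<Phi>] card_Suc_Diff1[OF fin[OF c\<Phi>] F(1)] Hn by simp
  have "\<not> (chain S \<and> ?\<Psi> \<subset> S)" for S
    using psubset_card_mono[OF fin[of S], of ?\<Psi>] le[of S] cardPsi by linarith
  then have \<Psi>: "?\<Psi> \<in> flags P" using c\<Psi> by (auto simp: flag_iff maxchain_def)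
  have off: "rank P x \<noteq> i \<longleftrightarrow> x \<noteq> F" if "x \<in> \<Phi>" for x
    using cmp(2)[OF c\<Phi> that F(1)] F by auto
  show ?thesis
  proof (rule ex1I[of _ ?\<Psi>])
    show "?\<Psi> \<in> flags P \<and> ?\<Psi> \<noteq> \<Phi> \<and> {F \<in> ?\<Psi>. rank P F \<noteq> i} = {F \<in> \<Phi>. rank P F \<noteq> i}"
      using \<Psi> Hn rH F by auto
  next
    fix X assume X: "X \<in> flags P \<and> X \<noteq> \<Phi> \<and> {F \<in> X. rank P F \<noteq> i} = {F \<in> \<Phi>. rank P F \<noteq> i}"
    then have cX: "chain X" by (simp add: flag_iff maxchain_def)
    have "i \<in> rank P ` X" using full[of X] X i by simp
    then obtain K where K: "K \<in> X" "rank P K = i" by auto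
    have "A \<in> {F \<in> X. rank P F \<noteq> i}" "B \<in> {F \<in> X. rank P F \<noteq> i}" using X A B by simp_all
    then have AX: "A \<in> X" "B \<in> X" by simp_all
    have XK: "X = insert K {F \<in> X. rank P F \<noteq> i}" using K by (auto dest: cmp(2)[OF cX _ K(1)])
    have PF: "\<Phi> = insert F {F \<in> \<Phi>. rank P F \<noteq> i}" using F off by auto
    have eq: "{F \<in> X. rank P F \<noteq> i} = {F \<in> \<Phi>. rank P F \<noteq> i}" using X by blast
    have XK': "X = insert K {F \<in> \<Phi>. rank P F \<noteq> i}" using XK unfolding eq .
    have "K \<noteq> F" using XK' PF X by force
    have "K \<in> ?M"
      using cmp(1)[OF cX AX(1) K(1)] cmp(1)[OF cX K(1) AX(2)] A B K ch_sub[OF cX] by auto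
    then have "K = H" using \<open>K \<noteq> F\<close> unfolding H(1) by simp
    moreover have "{F \<in> \<Phi>. rank P F \<noteq> i} = \<Phi> - {F}" using off by auto
    ultimately show "X = ?\<Psi>" using XK' by simp
  qed
qed

definition chiral :: "'a ranked_poset \<Rightarrow> int \<Rightarrow> bool" where
  "chiral P n \<longleftrightarrow> k_orbit_polytope 2 P n \<and>
    (\<forall>\<Phi> \<in> flags P. \<forall>\<Psi> \<in> flags P. adjacent \<Phi> \<Psi> \<longrightarrow> \<not> same_orbit P \<Phi> \<Psi>)"

definition in_class_2 :: "int set \<Rightarrow> 'a ranked_poset \<Rightarrow> int \<Rightarrow> bool" where
  "in_class_2 I P n \<longleftrightarrow> k_orbit_polytope 2 P n \<and> I \<subseteq> {0..n - 1} \<and>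
    (\<forall>\<Phi> \<in> flags P. \<forall>i \<in> {0..n - 1}. same_orbit P \<Phi> (flag_adj P i \<Phi>) \<longleftrightarrow> i \<in> I)"

definition hereditary :: "'a ranked_poset \<Rightarrow> int \<Rightarrow> bool" where
  "hereditary P n \<longleftrightarrow>
    (\<forall>F \<in> facets P n. \<forall>f \<in> automorphisms (facet_section P F).
      \<exists>g \<in> automorphisms P. \<forall>G \<in> faces (facet_section P F). g G = f G)"

end

theory Submission
  imports Defs
begin

text \<open>The flips \<open>\<Phi> \<mapsto> \<Phi>\<^sup>i\<close> commute with automorphisms, hence act on the flag orbits, and
  by flag-connectedness this action is transitive. Chirality of the facets and heredity say that
  all flips with \<open>i \<le> n - 2\<close> induce the same map \<open>a\<close> on orbits and that \<open>a\<close> has no fixed point.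
  Let \<open>b\<close> be the map induced by the flip at \<open>n - 1\<close>. A chiral polytope has rank at least 2, so
  \<open>n \<ge> 3\<close> and the flips at \<open>0\<close> and \<open>n - 1\<close> commute: the orbits form a transitive set for a
  quotient of the Klein four-group \<open>{1, a, b, ab}\<close> on which \<open>a\<close> acts freely. Either there are four
  orbits, or there are two and \<open>b\<close> is the identity (class \<open>2\<^bsub>{n-1}\<^esub>\<close>) or equals \<open>a\<close>
  (chiral).\<close>

section \<open>Faces, ranks and chains, and flags as chains with \<open>n + 2\<close>
  elements\<close>

context abstract_polytope
begin

abbreviation face_chain :: "'a set \<Rightarrow> bool" where
  "face_chain X \<equiv> pred_on.chain (faces P) (face_less P) X"

lemma face_chain_def:
  "face_chain X \<longleftrightarrow>
    X \<subseteq> faces P \<and> (\<forall>x\<in>X. \<forall>y\<in>X. face_less P x y \<or> x = y \<or> face_less P y x)"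
  by (auto simp: pred_on.chain_def)

lemma face_less_trans: "face_less P x y \<Longrightarrow> face_less P y z \<Longrightarrow> face_less P x z"
proof -
  assume a: "face_less P x y" "face_less P y z"
  then have "(x, z) \<in> leq P"
    using partial_order unfolding partial_order_on_def preorder_on_def face_less_def
    by (blast dest: transD)
  moreover have "x \<noteq> z" using rank_strict_mono[OF a(1)] rank_strict_mono[OF a(2)] by auto
  ultimately show ?thesis by (simp add: face_less_def)
qed

lemma rank_bounds: "F \<in> faces P \<Longrightarrow> -1 \<le> rank P F \<and> rank P F \<le> n"
  using rank_onto by (metis atLeastAtMost_iff image_eqI)

lemma rank_ge: "-1 \<le> n"
  using least rank_bounds unfolding is_least_face_def by (meson order.trans)

text \<open>A least face different from \<open>F\<close> would lie strictly below \<open>F\<close>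
  and so have rank less than -1, which no face has. It follows that only one face has rank
  -1.\<close>

lemma rank_minus_one_is_least: "F \<in> faces P \<Longrightarrow> rank P F = -1 \<Longrightarrow> is_least_face P F"
  using least rank_bounds rank_strict_mono unfolding is_least_face_def face_less_def
  by (metis linorder_not_less)

lemma rank_n_is_greatest: "F \<in> faces P \<Longrightarrow> rank P F = n \<Longrightarrow> is_greatest_face P F"
  using greatest rank_bounds rank_strict_mono unfolding is_greatest_face_def face_less_def
  by (metis linorder_not_less)

lemma leq_antisym: "(x, y) \<in> leq P \<Longrightarrow> (y, x) \<in> leq P \<Longrightarrow> x = y"
  using partial_order unfolding partial_order_on_def by (blast dest: antisymD)

lemma leq_refl: "x \<in> faces P \<Longrightarrow> (x, x) \<in> leq P"
  using partial_order unfolding partial_order_on_def preorder_on_def by (blast dest: refl_onD)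

lemma least_face_eq: "is_least_face P F \<Longrightarrow> least_face P = F"
  unfolding least_face_def
  by (rule the_equality) (auto simp: is_least_face_def intro: leq_antisym)

lemma greatest_unique: "is_greatest_face P F \<Longrightarrow> is_greatest_face P G \<Longrightarrow> F = G"
  by (auto simp: is_greatest_face_def intro: leq_antisym)

lemma least_face_is_least: "is_least_face P (least_face P)"
  using least least_face_eq by auto

lemma chain_less:
  "face_chain X \<Longrightarrow> x \<in> X \<Longrightarrow> y \<in> X \<Longrightarrow> rank P x < rank P y \<Longrightarrow> face_less P x y"
  unfolding face_chain_def using rank_strict_mono[of y x] by auto

lemma chain_inj: "face_chain X \<Longrightarrow> inj_on (rank P) X"
  unfolding face_chain_def inj_on_def by (metis less_irrefl rank_strict_mono)

lemma chain_eq: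
  "face_chain X \<Longrightarrow> x \<in> X \<Longrightarrow> y \<in> X \<Longrightarrow> rank P x = rank P y \<Longrightarrow> x = y"
  using chain_inj by (blast dest: inj_onD)

lemma chain_rank_image: "face_chain X \<Longrightarrow> rank P ` X \<subseteq> {-1..n}"
  unfolding face_chain_def using rank_onto by blast

lemma chain_finite: "face_chain X \<Longrightarrow> finite X"
  using finite_imageD[OF finite_subset[OF chain_rank_image] chain_inj] by simp

lemma chain_card_le: "face_chain X \<Longrightarrow> int (card X) \<le> n + 2"
proof -
  assume X: "face_chain X"
  have "card X = card (rank P ` X)" using chain_inj[OF X] by (simp add: card_image)
  also have "\<dots> \<le> card {-1..n}" using chain_rank_image[OF X] by (intro card_mono) auto
  finally show ?thesis using rank_ge by simp
qed

text \<open>The rank embeds a chain into \<open>{-1..n}\<close>, so no chain has more than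
  \<open>n + 2\<close> elements and one of that size cannot be enlarged. To recognise a flag it then
  suffices to check comparability and to count.\<close>

lemma flags_iff: "X \<in> flags P \<longleftrightarrow> face_chain X \<and> int (card X) = n + 2"
proof
  assume "X \<in> flags P"
  then show "face_chain X \<and> int (card X) = n + 2"
    using card_flag by (simp add: flags_def pred_on.maxchain_def)
next
  assume X: "face_chain X \<and> int (card X) = n + 2"
  then have "\<not> (face_chain S \<and> X \<subset> S)" for S
    using psubset_card_mono[OF chain_finite[of S], of X] chain_card_le[of S] by linarith
  then show "X \<in> flags P" using X by (auto simp: flags_def pred_on.maxchain_def)
qed

lemma flag_chain: "X \<in> flags P \<Longrightarrow> face_chain X"
  by (simp add: flags_iff)

lemma flag_faces: "X \<in> flags P \<Longrightarrow> x \<in> X \<Longrightarrow> x \<in> faces P"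
  using flag_chain face_chain_def by blast

lemma flag_finite: "X \<in> flags P \<Longrightarrow> finite X"
  using flag_chain chain_finite by blast

lemma flag_rank_image: "X \<in> flags P \<Longrightarrow> rank P ` X = {-1..n}"
proof (rule card_subset_eq)
  assume X: "X \<in> flags P"
  show "rank P ` X \<subseteq> {-1..n}" using chain_rank_image X flag_chain by blast
  show "card (rank P ` X) = card {-1..n}"
    using card_flag[OF X] chain_inj[OF flag_chain[OF X]] by (simp add: card_image)
qed simp

lemma flag_face_of_rank:
  assumes "X \<in> flags P" "-1 \<le> i" "i \<le> n"
  obtains F where "F \<in> X" "F \<in> faces P" "rank P F = i"
proof -
  have "i \<in> rank P ` X" using assms flag_rank_image by simp
  then show ?thesis using that flag_faces[OF assms(1)] by blast
qed

lemma greatest_in_flag: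
  assumes "X \<in> flags P" "is_greatest_face P T"
  shows "T \<in> X"
  using flag_face_of_rank[OF assms(1) rank_ge order_refl] rank_n_is_greatest greatest_unique assms(2)
  by metis

lemma rank_greatest:
  assumes "is_greatest_face P T"
  shows "rank P T = n"
proof -
  obtain F where "F \<in> faces P" "rank P F = n"
    using rank_onto rank_ge by (metis atLeastAtMost_iff image_iff order_refl)
  then show ?thesis using rank_n_is_greatest greatest_unique assms by blast
qed

section \<open>Adjacent flags and the flips of a flag\<close>

lemma flag_adj_flag: "\<Phi> \<in> flags P \<Longrightarrow> 0 \<le> i \<Longrightarrow> i \<le> n - 1 \<Longrightarrow> flag_adj P i \<Phi> \<in> flags P"
  and flag_adj_neq: "\<Phi> \<in> flags P \<Longrightarrow> 0 \<le> i \<Longrightarrow> i \<le> n - 1 \<Longrightarrow> flag_adj P i \<Phi> \<noteq> \<Phi>"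
  and flag_adj_off: "\<Phi> \<in> flags P \<Longrightarrow> 0 \<le> i \<Longrightarrow> i \<le> n - 1 \<Longrightarrow>
    {F \<in> flag_adj P i \<Phi>. rank P F \<noteq> i} = {F \<in> \<Phi>. rank P F \<noteq> i}"
  using theI'[OF flag_adj_ex1[of \<Phi> i]] unfolding flag_adj_def by blast+

lemma flag_adj_eqI:
  assumes "\<Phi> \<in> flags P" "0 \<le> i" "i \<le> n - 1" "\<Psi> \<in> flags P" "\<Psi> \<noteq> \<Phi>"
    "{F \<in> \<Psi>. rank P F \<noteq> i} = {F \<in> \<Phi>. rank P F \<noteq> i}"
  shows "flag_adj P i \<Phi> = \<Psi>"
  unfolding flag_adj_def
  by (rule the1_equality[OF flag_adj_ex1]) (use assms in auto)

lemma flag_adj_invol: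
  assumes "\<Phi> \<in> flags P" "0 \<le> i" "i \<le> n - 1"
  shows "flag_adj P i (flag_adj P i \<Phi>) = \<Phi>"
  using assms flag_adj_flag flag_adj_neq[of \<Phi> i] flag_adj_off[of \<Phi> i]
  by (intro flag_adj_eqI) auto

lemma flag_adj_mem_iff:
  assumes "\<Phi> \<in> flags P" "0 \<le> i" "i \<le> n - 1" "rank P F \<noteq> i"
  shows "F \<in> flag_adj P i \<Phi> \<longleftrightarrow> F \<in> \<Phi>"
  using flag_adj_off[OF assms(1-3)] assms(4) by blast

lemma flag_split:
  assumes "X \<in> flags P" "x \<in> X" "rank P x = i"
  shows "X = insert x {F \<in> X. rank P F \<noteq> i}"
  using assms by (blast dest: chain_eq[OF flag_chain])

text \<open>A flag is determined by its faces off rank \<open>i\<close> together with its one face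
  of rank \<open>i\<close>, so sharing that face as well would make the flags equal.\<close>

lemma flag_neqD:
  assumes "X \<in> flags P" "Y \<in> flags P" "X \<noteq> Y"
    "{F \<in> X. rank P F \<noteq> i} = {F \<in> Y. rank P F \<noteq> i}"
    "x \<in> X" "rank P x = i"
  shows "x \<notin> Y"
proof
  assume x: "x \<in> Y"
  show False
    using flag_split[OF assms(1,5,6)] flag_split[OF assms(2) x assms(6)] assms(3,4) by metis
qed

lemma flag_adj_adjacent:
  assumes X: "X \<in> flags P" and i: "0 \<le> i" "i \<le> n - 1"
  shows "adjacent X (flag_adj P i X)"
proof -
  let ?Y = "flag_adj P i X"
  note Y = flag_adj_flag[OF X i] flag_adj_neq[OF X i] flag_adj_off[OF X i]
  obtain x where x: "x \<in> X" "rank P x = i" by (rule flag_face_of_rank[OF X, of i]) (use i in auto)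
  obtain y where y: "y \<in> ?Y" "rank P y = i"
    by (rule flag_face_of_rank[OF Y(1), of i]) (use i in auto)
  have "X - ?Y = {x}"
    using flag_neqD[OF X Y(1) Y(2)[symmetric] Y(3)[symmetric] x] Y(3) flag_split[OF X x] x(1)
    by blast
  moreover have "?Y - X = {y}"
    using flag_neqD[OF Y(1) X Y(2,3) y] Y(3) flag_split[OF Y(1) y] y(1) by blast
  ultimately show ?thesis by (simp add: adjacent_def)
qed

text \<open>Adjacency is defined by counting, without ranks. The two exchanged faces have the same
  rank, because the face of \<open>Y\<close> at the rank of \<open>x\<close> cannot lie in
  \<open>X\<close> and hence is \<open>y\<close>. This lets paths of adjacent flags be read as
  sequences of flips.\<close>

lemma adjacent_flag_adj:
  assumes X: "X \<in> flags P" and Y: "Y \<in> flags P" and a: "adjacent X Y"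
  obtains i where "0 \<le> i" "i \<le> n - 1" "Y = flag_adj P i X"
proof -
  from a obtain x y where xy: "X - Y = {x}" "Y - X = {y}"
    unfolding adjacent_def by (meson card_1_singletonE)
  have xX: "x \<in> X" "x \<notin> Y" and yY: "y \<in> Y" "y \<notin> X" using xy by auto
  obtain z where z: "z \<in> Y" "rank P z = rank P x"
    using flag_face_of_rank[OF Y] rank_bounds[OF flag_faces[OF X xX(1)]] by metis
  have "z \<notin> X" using chain_eq[OF flag_chain[OF X] _ xX(1)] z xX(2) by metis
  then have zy: "z = y" using z xy by auto
  have rxy: "rank P x = rank P y" using z zy by simp
  have fx: "x \<in> faces P" "y \<in> faces P" using flag_faces X Y xX yY by auto
  have xny: "x \<noteq> y" using xX yY by auto
  \<comment> \<open>Ranks -1 and \<open>n\<close> are each taken by a single face, whereas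
    \<open>x\<close> and \<open>y\<close> are distinct faces of equal rank.\<close>
  have "rank P x \<noteq> -1"
    using rank_minus_one_is_least[OF fx(1)] rank_minus_one_is_least[OF fx(2)] least_face_eq rxy xny
    by metis
  moreover have "rank P x \<noteq> n"
    using rank_n_is_greatest[OF fx(1)] rank_n_is_greatest[OF fx(2)] greatest_unique rxy xny
    by metis
  ultimately have i: "0 \<le> rank P x" "rank P x \<le> n - 1" using rank_bounds[OF fx(1)] by auto
  have "flag_adj P (rank P x) X = Y"
  proof (rule flag_adj_eqI[OF X i Y])
    show "Y \<noteq> X" using xX by auto
    show "{F \<in> Y. rank P F \<noteq> rank P x} = {F \<in> X. rank P F \<noteq> rank P x}"
    proof (intro set_eqI)
      fix F
      have "F \<in> X \<longleftrightarrow> F \<in> Y" if "F \<noteq> x" "F \<noteq> y" using xy that by blast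
      then show "F \<in> {F \<in> Y. rank P F \<noteq> rank P x} \<longleftrightarrow> F \<in> {F \<in> X. rank P F \<noteq> rank P x}"
        using rxy by (cases "F = x \<or> F = y") auto
    qed
  qed
  then show ?thesis using that i by blast
qed

text \<open>A face of rank \<open>i + 1\<close> separates the two exchanged ranks and is kept by
  both flips. It makes the new faces \<open>a\<close> and \<open>c\<close> comparable, so both
  exchanges can be carried out at once, and either order of flips leads to that flag.\<close>

lemma flag_adj_commute:
  assumes X: "X \<in> flags P" and i: "0 \<le> i" and ij: "i + 2 \<le> j" and j: "j \<le> n - 1"
  shows "flag_adj P i (flag_adj P j X) = flag_adj P j (flag_adj P i X)"
proof -
  have i': "i \<le> n - 1" and j': "0 \<le> j" and nij: "i \<noteq> j" using i ij j by auto
  let ?A = "flag_adj P i X" and ?C = "flag_adj P j X"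
  note A = flag_adj_flag[OF X i i'] flag_adj_neq[OF X i i'] flag_adj_off[OF X i i']
  note C = flag_adj_flag[OF X j' j] flag_adj_neq[OF X j' j] flag_adj_off[OF X j' j]
  obtain a where a: "a \<in> ?A" "a \<in> faces P" "rank P a = i"
    by (rule flag_face_of_rank[OF A(1), of i]) (use i i' in auto)
  obtain c where c: "c \<in> ?C" "c \<in> faces P" "rank P c = j"
    by (rule flag_face_of_rank[OF C(1), of j]) (use j j' in auto)
  obtain y where y: "y \<in> X" "rank P y = i + 1"
    by (rule flag_face_of_rank[OF X, of "i + 1"]) (use i i' in auto)
  have aX: "a \<notin> X" using flag_neqD[OF A(1) X A(2,3) a(1,3)] .
  have cX: "c \<notin> X" using flag_neqD[OF C(1) X C(2,3) c(1,3)] .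
  have yA: "y \<in> ?A" "y \<in> ?C" using y A(3) C(3) ij by auto
  have ac: "face_less P a c"
  proof (rule face_less_trans)
    show "face_less P a y" using chain_less[OF flag_chain[OF A(1)] a(1) yA(1)] a y by simp
    show "face_less P y c" using chain_less[OF flag_chain[OF C(1)] yA(2) c(1)] c y ij by simp
  qed
  \<comment> \<open>\<open>?D\<close> is \<open>X\<close> with its faces of ranks \<open>i\<close>
    and \<open>j\<close> replaced by \<open>a\<close> and \<open>c\<close>; it will be the common
    value of both sides.\<close>
  let ?Z = "{F \<in> X. rank P F \<noteq> i \<and> rank P F \<noteq> j}"
  let ?D = "insert a (insert c ?Z)"
  have A_eq: "{F \<in> ?A. rank P F \<noteq> j} = insert a ?Z"
    using flag_split[OF A(1) a(1,3)] a(3) nij unfolding A(3) by blast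
  have C_eq: "{F \<in> ?C. rank P F \<noteq> i} = insert c ?Z"
    using flag_split[OF C(1) c(1,3)] c(3) nij unfolding C(3) by blast
  have ZA: "insert a ?Z \<subseteq> ?A" "insert c ?Z \<subseteq> ?C" using A_eq C_eq by blast+
  have chD: "face_chain ?D"
    unfolding face_chain_def
  proof (intro conjI ballI)
    show "?D \<subseteq> faces P" using a c flag_faces[OF X] by blast
    \<comment> \<open>Two faces of \<open>?D\<close> lie together in one of the flags
      \<open>?A\<close> and \<open>?C\<close>, unless they are \<open>a\<close> and
      \<open>c\<close>.\<close>
    fix x y assume "x \<in> ?D" "y \<in> ?D"
    then consider "x \<in> ?A" "y \<in> ?A" | "x \<in> ?C" "y \<in> ?C" | "x = a" "y = c" | "x = c" "y = a"
      using ZA by blast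
    then show "face_less P x y \<or> x = y \<or> face_less P y x"
    proof cases
      case 1
      then show ?thesis using flag_chain[OF A(1)] unfolding face_chain_def by blast
    next
      case 2
      then show ?thesis using flag_chain[OF C(1)] unfolding face_chain_def by blast
    qed (use ac in auto)
  qed
  have "int (card ?D) = n + 2"
  proof -
    obtain x where x: "x \<in> X" "rank P x = i"
      by (rule flag_face_of_rank[OF X, of i]) (use i i' in auto)
    obtain z where z: "z \<in> X" "rank P z = j"
      by (rule flag_face_of_rank[OF X, of j]) (use j j' in auto)
    have "X = insert x (insert z ?Z)"
      using flag_split[OF X x] flag_split[OF X z] x(1) z(1) by blast
    moreover have "finite ?Z" using flag_finite[OF X] by simp
    ultimately have "card X = Suc (Suc (card ?Z))"
      using x z nij by (metis (mono_tags, lifting) card_insert_disjoint finite_insert insert_iff mem_Collect_eq)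
    moreover have "card ?D = Suc (Suc (card ?Z))"
    proof -
      have "a \<noteq> c" "a \<notin> ?Z" "c \<notin> ?Z" using aX cX a(3) c(3) nij by auto
      then show ?thesis using \<open>finite ?Z\<close> by simp
    qed
    ultimately show ?thesis using card_flag[OF X] by simp
  qed
  then have D: "?D \<in> flags P" using chD by (simp add: flags_iff)
  have "flag_adj P i ?C = ?D"
  proof (rule flag_adj_eqI[OF C(1) i i' D])
    have "a \<notin> ?C" using aX flag_adj_mem_iff[OF X j' j, of a] a(3) nij by simp
    then show "?D \<noteq> ?C" by auto
    show "{F \<in> ?D. rank P F \<noteq> i} = {F \<in> ?C. rank P F \<noteq> i}"
      unfolding C_eq using a c nij by auto
  qed
  moreover have "flag_adj P j ?A = ?D"
  proof (rule flag_adj_eqI[OF A(1) j' j D])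
    have "c \<notin> ?A" using cX flag_adj_mem_iff[OF X i i', of c] c(3) nij by simp
    then show "?D \<noteq> ?A" by auto
    show "{F \<in> ?D. rank P F \<noteq> j} = {F \<in> ?A. rank P F \<noteq> j}"
      unfolding A_eq using a c nij by auto
  qed
  ultimately show ?thesis by simp
qed

section \<open>Automorphisms acting on flags\<close>

lemma automorphism_leq_iff:
  assumes "f \<in> automorphisms P" "x \<in> faces P" "y \<in> faces P"
  shows "(f x, f y) \<in> leq P \<longleftrightarrow> (x, y) \<in> leq P"
  using assms by (simp add: automorphisms_def isomorphisms_def)

lemma automorphism_less_iff:
  assumes "f \<in> automorphisms P" "x \<in> faces P" "y \<in> faces P"
  shows "face_less P (f x) (f y) \<longleftrightarrow> face_less P x y"
  using assms unfolding automorphisms_def isomorphisms_def face_less_def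
  by (auto simp: bij_betw_def dest: inj_onD)

lemma automorphism_face: "f \<in> automorphisms P \<Longrightarrow> x \<in> faces P \<Longrightarrow> f x \<in> faces P"
  unfolding automorphisms_def isomorphisms_def by (auto simp: bij_betw_def)

lemma automorphism_inj: "f \<in> automorphisms P \<Longrightarrow> inj_on f (faces P)"
  unfolding automorphisms_def isomorphisms_def by (auto simp: bij_betw_def)

lemma automorphism_flag:
  assumes f: "f \<in> automorphisms P" and X: "X \<in> flags P"
  shows "f ` X \<in> flags P"
proof -
  have "face_chain (f ` X)"
    using flag_chain[OF X] automorphism_less_iff[OF f] automorphism_face[OF f]
    unfolding face_chain_def by (simp add: subset_iff) blast
  moreover have "card (f ` X) = card X"
    using automorphism_inj[OF f] flag_faces[OF X] by (intro card_image) (auto simp: inj_on_def)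
  ultimately show ?thesis using X by (simp add: flags_iff)
qed

text \<open>Expresses the rank through the order alone. This is needed because automorphisms are
  only required to respect the order, and preservation of ranks must be derived.\<close>

lemma rank_in_flag:
  assumes X: "X \<in> flags P" and x: "x \<in> X"
  shows "rank P x = int (card {y \<in> X. face_less P y x}) - 1"
proof -
  let ?S = "{y \<in> X. face_less P y x}"
  \<comment> \<open>A flag has exactly one face of each rank, so below \<open>x\<close> the ranks
    from -1 to \<open>rank P x - 1\<close> each occur once, which makes \<open>rank P x + 1\<close>
    faces.\<close>
  have "rank P ` ?S = {-1..<rank P x}"
  proof (intro equalityI subsetI)
    fix r assume r: "r \<in> {-1..<rank P x}"
    then obtain y where y: "y \<in> X" "rank P y = r"
      using flag_face_of_rank[OF X, of r] rank_bounds[OF flag_faces[OF X x]] by auto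
    then show "r \<in> rank P ` ?S" using chain_less[OF flag_chain[OF X] y(1) x] r by auto
  qed (use rank_strict_mono rank_bounds flag_faces[OF X] in auto)
  then have "card ?S = card {-1..<rank P x}"
    using card_image[of "rank P" ?S] chain_inj[OF flag_chain[OF X]]
    by (metis (no_types, lifting) inj_on_subset mem_Collect_eq subsetI)
  then show ?thesis using rank_bounds[OF flag_faces[OF X x]] by simp
qed

lemma automorphism_rank:
  assumes f: "f \<in> automorphisms P" and X: "X \<in> flags P" and x: "x \<in> X"
  shows "rank P (f x) = rank P x"
proof -
  have "{y \<in> f ` X. face_less P y (f x)} = f ` {y \<in> X. face_less P y x}"
    using automorphism_less_iff[OF f] flag_faces[OF X] x by auto
  moreover have "inj_on f {y \<in> X. face_less P y x}"
    using automorphism_inj[OF f] flag_faces[OF X] by (auto simp: inj_on_def)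
  ultimately have "card {y \<in> f ` X. face_less P y (f x)} = card {y \<in> X. face_less P y x}"
    by (simp add: card_image)
  then show ?thesis
    using rank_in_flag[OF X x] rank_in_flag[OF automorphism_flag[OF f X], of "f x"] x by simp
qed

text \<open>Automorphisms preserve ranks, so the image of the flipped flag has the property that
  characterises the flip of the image uniquely. This is what makes the flips act on orbits.\<close>

lemma automorphism_flag_adj:
  assumes f: "f \<in> automorphisms P" and X: "X \<in> flags P" and i: "0 \<le> i" "i \<le> n - 1"
  shows "f ` flag_adj P i X = flag_adj P i (f ` X)"
proof (rule flag_adj_eqI[symmetric])
  let ?Y = "flag_adj P i X"
  note Y = flag_adj_flag[OF X i] flag_adj_neq[OF X i] flag_adj_off[OF X i]
  show "f ` X \<in> flags P" "f ` ?Y \<in> flags P" using automorphism_flag f X Y by auto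
  show "f ` ?Y \<noteq> f ` X"
    using inj_on_image_eq_iff[OF automorphism_inj[OF f], of ?Y X] Y(2) flag_faces[OF X] flag_faces[OF Y(1)]
    by blast
  have "{F \<in> f ` Z. rank P F \<noteq> i} = f ` {F \<in> Z. rank P F \<noteq> i}" if "Z \<in> flags P" for Z
    using automorphism_rank[OF f that] by auto
  then show "{F \<in> f ` ?Y. rank P F \<noteq> i} = {F \<in> f ` X. rank P F \<noteq> i}"
    using X Y by simp
qed (use i in auto)

section \<open>Flag orbits and induction along flips\<close>

lemma same_orbit_refl: "same_orbit P X X"
  unfolding same_orbit_def automorphisms_def isomorphisms_def
  by (rule bexI[of _ id]) (auto simp: bij_betw_def)

lemma same_orbit_trans: "same_orbit P X Y \<Longrightarrow> same_orbit P Y Z \<Longrightarrow> same_orbit P X Z"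
proof -
  assume "same_orbit P X Y" "same_orbit P Y Z"
  then obtain f g where fg: "f \<in> automorphisms P" "g \<in> automorphisms P" "Y = f ` X" "Z = g ` Y"
    unfolding same_orbit_def by blast
  have "(x, y) \<in> leq P \<longleftrightarrow> (g (f x), g (f y)) \<in> leq P" if "x \<in> faces P" "y \<in> faces P" for x y
    using automorphism_leq_iff[OF fg(1) that]
      automorphism_leq_iff[OF fg(2) automorphism_face[OF fg(1) that(1)] automorphism_face[OF fg(1) that(2)]]
    by simp
  moreover have "bij_betw (g \<circ> f) (faces P) (faces P)"
    using fg(1,2) by (auto simp: automorphisms_def isomorphisms_def intro: bij_betw_trans)
  ultimately have "g \<circ> f \<in> automorphisms P"
    by (simp add: automorphisms_def isomorphisms_def)
  then show ?thesis unfolding same_orbit_def using fg by (metis image_comp)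
qed

text \<open>The inverse of an automorphism is formed on the faces only, so \<open>X\<close> has to
  consist of faces for it to be recovered from its image.\<close>

lemma same_orbit_sym:
  assumes X: "X \<in> flags P" and o: "same_orbit P X Y"
  shows "same_orbit P Y X"
proof -
  obtain f where f: "f \<in> automorphisms P" "Y = f ` X" using o unfolding same_orbit_def by blast
  let ?g = "inv_into (faces P) f"
  have b: "bij_betw f (faces P) (faces P)" using f by (simp add: automorphisms_def isomorphisms_def)
  have bg: "bij_betw ?g (faces P) (faces P)" by (rule bij_betw_inv_into[OF b])
  have fg: "f (?g x) = x" "?g x \<in> faces P" if "x \<in> faces P" for x
    using bij_betw_inv_into_right[OF b that] bg that by (auto simp: bij_betw_def)
  have "?g \<in> automorphisms P"
    using bg f(1) fg unfolding automorphisms_def isomorphisms_def by simp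
  moreover have "?g ` Y = X"
    using inv_into_image_cancel[of f "faces P" X] automorphism_inj f flag_faces[OF X] by blast
  ultimately show ?thesis unfolding same_orbit_def by blast
qed

lemma same_orbit_flag_adj:
  assumes "X \<in> flags P" "0 \<le> i" "i \<le> n - 1" "same_orbit P X Y"
  shows "same_orbit P (flag_adj P i X) (flag_adj P i Y)"
  using assms automorphism_flag_adj unfolding same_orbit_def by blast

definition orbit_of :: "'a set \<Rightarrow> 'a set set" where
  "orbit_of X = {Y \<in> flags P. same_orbit P X Y}"

lemma flag_orbits_eq: "flag_orbits P = orbit_of ` flags P"
  unfolding flag_orbits_def quotient_def orbit_of_def by (auto simp: Image_def)

lemma orbit_of_eq_iff:
  assumes "X \<in> flags P" "Y \<in> flags P"
  shows "orbit_of X = orbit_of Y \<longleftrightarrow> same_orbit P X Y"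
  using assms same_orbit_refl same_orbit_sym same_orbit_trans unfolding orbit_of_def by blast

lemma flags_nonempty: "flags P \<noteq> {}"
  using pred_on.Hausdorff[of "faces P" "face_less P"] unfolding flags_def by blast

text \<open>Flag-connectedness as an induction rule: any two flags are joined by adjacent ones, and
  each such step is a flip.\<close>

lemma flags_induct [consumes 2, case_names base step]:
  assumes "X \<in> flags P" "Y \<in> flags P" "Q X"
    and "\<And>Z i. Z \<in> flags P \<Longrightarrow> Q Z \<Longrightarrow> 0 \<le> i \<Longrightarrow> i \<le> n - 1 \<Longrightarrow> Q (flag_adj P i Z)"
  shows "Q Y"
proof -
  have "(X, Y) \<in> {(A, B). A \<in> flags P \<and> B \<in> flags P \<and> adjacent A B \<and> X \<inter> Y \<subseteq> A \<and> X \<inter> Y \<subseteq> B}\<^sup>*"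
    using connected assms(1,2) unfolding strongly_flag_connected_def by blast
  then show ?thesis
  proof (induction rule: rtrancl_induct)
    case (step Z W)
    then have ZW: "Z \<in> flags P" "W \<in> flags P" "adjacent Z W" by auto
    obtain i where "0 \<le> i" "i \<le> n - 1" "W = flag_adj P i Z" by (rule adjacent_flag_adj[OF ZW])
    then show ?case using assms(4) ZW(1) step.IH by simp
  qed (rule assms(3))
qed

end

section \<open>Consequences of chirality: the two orbits and the least possible rank\<close>

context abstract_polytope
begin

text \<open>Both \<open>B\<close> and \<open>C\<close> avoid the orbit of \<open>A\<close>, and only
  one other orbit exists.\<close>

lemma two_orbits_adjacent:
  assumes chi: "chiral P n" and A: "A \<in> flags P" "B \<in> flags P" "C \<in> flags P"
    and adj: "adjacent A B" "adjacent A C"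
  shows "same_orbit P B C"
proof (rule ccontr)
  assume "\<not> same_orbit P B C"
  moreover have "\<not> same_orbit P A B" "\<not> same_orbit P A C"
    using chi A adj unfolding chiral_def by auto
  ultimately have "card {orbit_of A, orbit_of B, orbit_of C} = 3"
    using A orbit_of_eq_iff by simp
  moreover have "{orbit_of A, orbit_of B, orbit_of C} \<subseteq> flag_orbits P"
    using A by (auto simp: flag_orbits_eq)
  ultimately have "3 \<le> card (flag_orbits P)"
    using chi card_mono unfolding chiral_def k_orbit_polytope_def by metis
  then show False using chi unfolding chiral_def k_orbit_polytope_def by simp
qed

text \<open>For \<open>n\<close> below 1 there are no flips, so connectedness leaves a single flag
  and hence a single orbit.\<close>

lemma chiral_rank_ge_1:
  assumes chi: "chiral P n"
  shows "1 \<le> n"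
proof (rule ccontr)
  assume n: "\<not> 1 \<le> n"
  obtain X where X: "X \<in> flags P" using flags_nonempty by blast
  have "Y = X" if "Y \<in> flags P" for Y
    using X that by (induction rule: flags_induct) (use n in auto)
  then have "flag_orbits P \<subseteq> {orbit_of X}" by (auto simp: flag_orbits_eq)
  then have "card (flag_orbits P) \<le> 1" using card_mono[of "{orbit_of X}"] by simp
  then show False using chi unfolding chiral_def k_orbit_polytope_def by simp
qed

text \<open>In rank 1 the order is determined by the ranks, so exchanging two vertices is an automorphism.\<close>

lemma chiral_rank_ge_2:
  assumes chi: "chiral P n"
  shows "2 \<le> n"
proof (rule ccontr)
  assume "\<not> 2 \<le> n"
  then have n: "n = 1" using chiral_rank_ge_1[OF chi] by simp
  have leq_iff: "(x, y) \<in> leq P \<longleftrightarrow> x = y \<or> rank P x < rank P y"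
    if x: "x \<in> faces P" and y: "y \<in> faces P" for x y
  proof
    assume "(x, y) \<in> leq P"
    then show "x = y \<or> rank P x < rank P y"
      using rank_strict_mono[of x y] by (auto simp: face_less_def)
  next
    assume "x = y \<or> rank P x < rank P y"
    \<comment> \<open>With ranks confined to -1, 0 and 1, of two different ranks the smaller is -1
      or the larger is 1.\<close>
    then consider "x = y" | "rank P x = -1" | "rank P y = n"
      using rank_bounds[OF x] rank_bounds[OF y] n by linarith
    then show "(x, y) \<in> leq P"
    proof cases
      case 2
      then show ?thesis using rank_minus_one_is_least[OF x] y by (auto simp: is_least_face_def)
    next
      case 3
      then show ?thesis using rank_n_is_greatest[OF y] x by (auto simp: is_greatest_face_def)
    qed (use leq_refl x in simp)
  qed
  obtain X where X: "X \<in> flags P" using flags_nonempty by blast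
  have i: "0 \<le> (0::int)" "0 \<le> n - 1" using n by auto
  let ?Y = "flag_adj P 0 X"
  note Y = flag_adj_flag[OF X i] flag_adj_off[OF X i]
  obtain v where v: "v \<in> X" "v \<in> faces P" "rank P v = 0"
    by (rule flag_face_of_rank[OF X, of 0]) (use n in auto)
  obtain w where w: "w \<in> ?Y" "w \<in> faces P" "rank P w = 0"
    by (rule flag_face_of_rank[OF Y(1), of 0]) (use n in auto)
  define f where "f = id(v := w, w := v)"
  have ff: "f (f x) = x" and rf: "rank P (f x) = rank P x" for x
    using v w by (auto simp: f_def)
  have fin: "f x \<in> faces P" if "x \<in> faces P" for x
    using v w that by (auto simp: f_def)
  have "bij_betw f (faces P) (faces P)"
    by (rule bij_betw_byWitness[of _ f]) (use ff fin in auto)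
  moreover have "f x = f y \<longleftrightarrow> x = y" for x y using ff by metis
  ultimately have "f \<in> automorphisms P"
    unfolding automorphisms_def isomorphisms_def by (simp add: leq_iff fin rf)
  moreover have "f ` X = ?Y"
  proof -
    \<comment> \<open>\<open>f\<close> moves only \<open>v\<close> and \<open>w\<close>, both of
      rank 0, so every other face of the flag stays in place.\<close>
    have "f ` {F \<in> X. rank P F \<noteq> 0} = {F \<in> X. rank P F \<noteq> 0}"
      using v w by (auto simp: f_def image_iff)
    then have "f ` X = insert (f v) {F \<in> X. rank P F \<noteq> 0}"
      using arg_cong[OF flag_split[OF X v(1,3)], of "image f"] by (simp only: image_insert)
    moreover have "f v = w" by (simp add: f_def)
    ultimately show ?thesis using flag_split[OF Y(1) w(1,3)] unfolding Y(2) by metis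
  qed
  ultimately have "same_orbit P X ?Y" unfolding same_orbit_def by blast
  then show False
    using chi X Y(1) flag_adj_adjacent[OF X i] unfolding chiral_def by blast
qed

section \<open>Facet sections and the flags through a facet\<close>

lemma facet_section_faces:
  "faces (facet_section P F) = {H \<in> faces P. (H, F) \<in> leq P}"
  using least_face_is_least by (auto simp: face_section_def is_least_face_def Let_def)

lemma facet_section_leq:
  "leq (facet_section P F) = Restr (leq P) (faces (facet_section P F))"
  by (simp add: face_section_def Let_def)

lemma facet_section_less:
  "x \<in> faces (facet_section P F) \<Longrightarrow> y \<in> faces (facet_section P F) \<Longrightarrow>
    face_less (facet_section P F) x y \<longleftrightarrow> face_less P x y"
  by (simp add: face_less_def facet_section_leq)

text \<open>Serves two purposes: an automorphism fixing \<open>F\<close> restricts to an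
  automorphism of the facet, and one taking \<open>F\<close> to another facet makes the two facets
  isomorphic.\<close>

lemma automorphism_facet_section_iso:
  assumes g: "g \<in> automorphisms P" and F: "F \<in> faces P"
  shows "g \<in> isomorphisms (facet_section P F) (facet_section P (g F))"
proof -
  have b: "g ` faces P = faces P" and l: "\<And>x y. x \<in> faces P \<Longrightarrow> y \<in> faces P \<Longrightarrow>
      (g x, g y) \<in> leq P \<longleftrightarrow> (x, y) \<in> leq P"
    using g unfolding automorphisms_def isomorphisms_def by (auto simp: bij_betw_def)
  have im: "g ` faces (facet_section P F) = faces (facet_section P (g F))"
    unfolding facet_section_faces using b l F by (auto 0 4 simp: image_iff)
  moreover have "inj_on g (faces (facet_section P F))"
    using automorphism_inj[OF g] by (auto simp: facet_section_faces inj_on_def)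
  moreover have "(x, y) \<in> leq (facet_section P F) \<longleftrightarrow> (g x, g y) \<in> leq (facet_section P (g F))"
    if "x \<in> faces (facet_section P F)" "y \<in> faces (facet_section P F)" for x y
  proof -
    have "g x \<in> faces (facet_section P (g F))" "g y \<in> faces (facet_section P (g F))"
      using im that by blast+
    then show ?thesis
      using that l[of x y] by (simp add: facet_section_leq facet_section_faces)
  qed
  ultimately show ?thesis by (simp add: isomorphisms_def bij_betw_def)
qed

context
  fixes F T
  assumes F: "F \<in> facets P n" and T: "is_greatest_face P T"
    and sec_poly: "abstract_polytope (facet_section P F) (n - 1)"
begin

interpretation Q: abstract_polytope "facet_section P F" "n - 1"
  by (rule sec_poly)

lemma facet_face: "F \<in> faces P" and facet_rank: "rank P F = n - 1"
  using F by (auto simp: facets_def)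

lemma greatest_not_in_section: "T \<notin> faces (facet_section P F)"
  using leq_antisym[of T F] T facet_face facet_rank rank_greatest[OF T]
  by (auto simp: facet_section_faces is_greatest_face_def)

text \<open>One half of the correspondence between flags of the facet and flags of \<open>P\<close>
  through \<open>F\<close>. The greatest face \<open>T\<close> lies above the whole section but
  outside it, so adding it keeps a chain and raises the size from \<open>n + 1\<close> to
  \<open>n + 2\<close>.\<close>

lemma section_flag_insert:
  assumes Y: "Y \<in> flags (facet_section P F)"
  shows "insert T Y \<in> flags P" "F \<in> Y" "T \<notin> Y"
proof -
  have sub: "Y \<subseteq> faces (facet_section P F)" using Q.flag_faces[OF Y] by blast
  show TY: "T \<notin> Y" using sub greatest_not_in_section by blast
  have "is_greatest_face (facet_section P F) F"
    using facet_face leq_refl[OF facet_face]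
    by (auto simp: is_greatest_face_def facet_section_leq facet_section_faces)
  then show "F \<in> Y" using Q.greatest_in_flag[OF Y] by blast
  have "face_chain (insert T Y)"
    unfolding face_chain_def
  proof (intro conjI ballI)
    show "insert T Y \<subseteq> faces P"
      using sub T by (auto simp: facet_section_faces is_greatest_face_def)
    fix x y assume xy: "x \<in> insert T Y" "y \<in> insert T Y"
    have top: "z = T \<or> face_less P z T" if "z \<in> insert T Y" for z
      using that sub T by (auto simp: facet_section_faces is_greatest_face_def face_less_def)
    show "face_less P x y \<or> x = y \<or> face_less P y x"
    proof (cases "x = T \<or> y = T")
      case False
      then have "x \<in> Y" "y \<in> Y" using xy by auto
      then show ?thesis
        using Q.flag_chain[OF Y] facet_section_less[of x F y] facet_section_less[of y F x] sub
        unfolding Q.face_chain_def by blast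
    qed (use top xy in blast)
  qed
  moreover have "int (card (insert T Y)) = n + 2"
    using Q.card_flag[OF Y] Q.flag_finite[OF Y] TY by simp
  ultimately show "insert T Y \<in> flags P" by (simp add: flags_iff)
qed

text \<open>The converse half. Only \<open>T\<close> has rank \<open>n\<close>, so the remaining
  faces have rank at most that of \<open>F\<close>; being comparable with \<open>F\<close>, they lie
  in the section.\<close>

lemma flag_remove_greatest:
  assumes X: "X \<in> flags P" and FX: "F \<in> X"
  shows "X - {T} \<in> flags (facet_section P F)"
proof -
  have sub: "X - {T} \<subseteq> faces (facet_section P F)"
  proof
    fix x assume x: "x \<in> X - {T}"
    then have xP: "x \<in> faces P" using flag_faces[OF X] by blast
    have "rank P x \<noteq> n" using x rank_n_is_greatest[OF xP] greatest_unique T by blast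
    then have "rank P x \<le> rank P F" using rank_bounds[OF xP] facet_rank by simp
    then have "x = F \<or> face_less P x F"
      using x chain_less[OF flag_chain[OF X] _ FX, of x] chain_eq[OF flag_chain[OF X] _ FX, of x]
      by fastforce
    then show "x \<in> faces (facet_section P F)"
      using xP leq_refl[OF xP] by (auto simp: facet_section_faces face_less_def)
  qed
  have "Q.face_chain (X - {T})"
    unfolding Q.face_chain_def
  proof (intro conjI ballI)
    fix x y assume "x \<in> X - {T}" "y \<in> X - {T}"
    then show "face_less (facet_section P F) x y \<or> x = y \<or> face_less (facet_section P F) y x"
      using flag_chain[OF X] facet_section_less[of x F y] facet_section_less[of y F x] sub
      unfolding face_chain_def by blast
  qed (rule sub)
  moreover have "int (card (X - {T})) = (n - 1) + 2"
    using card_flag[OF X] flag_finite[OF X] greatest_in_flag[OF X T] rank_ge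
      card_Suc_Diff1[OF flag_finite[OF X] greatest_in_flag[OF X T]] by linarith
  ultimately show ?thesis by (simp add: Q.flags_iff)
qed

text \<open>The section, being a polytope, has a flag, and adding the greatest face extends it to a
  flag of \<open>P\<close>.\<close>

lemma flag_through_facet: "\<exists>X \<in> flags P. F \<in> X"
  using Q.flags_nonempty section_flag_insert by blast

end

end

section \<open>Hereditary polytopes with chiral facets: flips inside a facet\<close>

locale hereditary_chiral_facets = abstract_polytope P n for P :: "'a ranked_poset" and n +
  assumes hereditary: "hereditary P n"
    and chiral_facets: "F \<in> facets P n \<Longrightarrow> chiral (facet_section P F) (n - 1)"
begin

lemma section_polytope: "F \<in> facets P n \<Longrightarrow> abstract_polytope (facet_section P F) (n - 1)"
  using chiral_facets unfolding chiral_def k_orbit_polytope_def by blast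

lemma flag_facet:
  assumes X: "X \<in> flags P" and n: "0 \<le> n"
  obtains F where "F \<in> X" "F \<in> facets P n"
  by (rule flag_face_of_rank[OF X, of "n - 1"]) (use n in \<open>auto simp: facets_def\<close>)

text \<open>Chiral facets have rank \<open>n - 1\<close> at least 2. The assumption
  \<open>0 \<le> n\<close> provides a facet to apply this to; for \<open>n = -1\<close> there would
  be none.\<close>

lemma rank_ge_3: "0 \<le> n \<Longrightarrow> 3 \<le> n"
proof -
  assume n: "0 \<le> n"
  obtain X where "X \<in> flags P" using flags_nonempty by blast
  then obtain F where F: "F \<in> facets P n" using flag_facet n by metis
  show "3 \<le> n"
    using abstract_polytope.chiral_rank_ge_2[OF section_polytope[OF F] chiral_facets[OF F]] by simp
qed

lemma adjacent_remove:
  assumes "adjacent X Y" "T \<in> X" "T \<in> Y"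
  shows "adjacent (X - {T}) (Y - {T})"
proof -
  have "(X - {T}) - (Y - {T}) = X - Y" "(Y - {T}) - (X - {T}) = Y - X" using assms(2,3) by auto
  then show ?thesis using assms(1) by (simp add: adjacent_def)
qed

text \<open>A flip at rank at most \<open>n - 2\<close> keeps the facet and the greatest face, so it
  takes place inside the facet.\<close>

lemma flag_adj_section:
  assumes X: "X \<in> flags P" and F: "F \<in> X" "F \<in> facets P n" and T: "is_greatest_face P T"
    and i: "0 \<le> i" "i \<le> n - 2"
  shows "flag_adj P i X - {T} \<in> flags (facet_section P F)"
    and "adjacent (X - {T}) (flag_adj P i X - {T})"
proof -
  have i': "i \<le> n - 1" using i by simp
  have Y: "flag_adj P i X \<in> flags P" using flag_adj_flag[OF X i(1) i'] .
  have "F \<in> flag_adj P i X"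
    using flag_adj_mem_iff[OF X i(1) i', of F] F i by (simp add: facets_def)
  then show "flag_adj P i X - {T} \<in> flags (facet_section P F)"
    using flag_remove_greatest[OF F(2) T section_polytope[OF F(2)] Y] by blast
  show "adjacent (X - {T}) (flag_adj P i X - {T})"
    using adjacent_remove[OF flag_adj_adjacent[OF X i(1) i']] greatest_in_flag[OF X T]
      greatest_in_flag[OF Y T] by blast
qed

text \<open>Inside the facet both flips lead to the orbit not containing the given flag. Heredity
  extends the facet automorphism joining the results to all of \<open>P\<close>. On orbits, all
  flips below rank \<open>n - 1\<close> therefore act alike.\<close>

lemma low_adjacent_same_orbit:
  assumes X: "X \<in> flags P" and i: "0 \<le> i" "i \<le> n - 2" and j: "0 \<le> j" "j \<le> n - 2"
  shows "same_orbit P (flag_adj P i X) (flag_adj P j X)"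
proof -
  obtain T where T: "is_greatest_face P T" using greatest by blast
  obtain F where F: "F \<in> X" "F \<in> facets P n" using flag_facet[OF X] i by auto
  interpret Q: abstract_polytope "facet_section P F" "n - 1" using section_polytope[OF F(2)] .
  let ?Y = "flag_adj P i X" and ?Z = "flag_adj P j X"
  note sec = flag_adj_section[OF X F T]
  have "same_orbit (facet_section P F) (?Y - {T}) (?Z - {T})"
    using Q.two_orbits_adjacent[OF chiral_facets[OF F(2)]] sec[OF i] sec[OF j]
      flag_remove_greatest[OF F(2) T section_polytope[OF F(2)] X F(1)] by blast
  then obtain f where f: "f \<in> automorphisms (facet_section P F)" "?Z - {T} = f ` (?Y - {T})"
    unfolding same_orbit_def by blast
  obtain g where g: "g \<in> automorphisms P" "\<forall>G \<in> faces (facet_section P F). g G = f G"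
    using hereditary F(2) f(1) unfolding hereditary_def by blast
  have TYZ: "T \<in> ?Y" "T \<in> ?Z" and Y: "?Y \<in> flags P"
    using greatest_in_flag[OF _ T] flag_adj_flag[OF X] i j by auto
  \<comment> \<open>Heredity prescribes \<open>g\<close> on the section only. That it also fixes
    \<open>T\<close> follows because \<open>T\<close> is the only face of rank
    \<open>n\<close>.\<close>
  have "rank P (g T) = n" using automorphism_rank[OF g(1) Y TYZ(1)] rank_greatest[OF T] by simp
  then have gT: "g T = T"
    using rank_n_is_greatest greatest_unique T automorphism_face[OF g(1)]
    by (metis is_greatest_face_def)
  have "g ` (?Y - {T}) = f ` (?Y - {T})"
    using g(2) Q.flag_faces[OF sec(1)[OF i]] by (intro image_cong) auto
  then have "g ` ?Y = ?Z" using f(2) TYZ gT by (metis image_insert insert_Diff)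
  then show ?thesis using g(1) unfolding same_orbit_def by blast
qed

text \<open>An automorphism carrying \<open>X\<close> to its flip would preserve ranks and so fix
  the facet and the greatest face, which both flags share. Restricted to the facet it would join two
  adjacent flags, against chirality.\<close>

lemma low_adjacent_other_orbit:
  assumes X: "X \<in> flags P" and i: "0 \<le> i" "i \<le> n - 2"
  shows "\<not> same_orbit P X (flag_adj P i X)"
proof
  let ?Y = "flag_adj P i X"
  assume "same_orbit P X ?Y"
  then obtain g where g: "g \<in> automorphisms P" "?Y = g ` X" unfolding same_orbit_def by blast
  obtain T where T: "is_greatest_face P T" using greatest by blast
  obtain F where F: "F \<in> X" "F \<in> facets P n" using flag_facet[OF X] i by auto
  note sec = flag_adj_section[OF X F T i]
  have i': "i \<le> n - 1" using i by simp
  note Y = flag_adj_flag[OF X i(1) i']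
  have TX: "T \<in> X" "T \<in> ?Y" using greatest_in_flag[OF _ T] X Y by auto
  have rF: "rank P F = n - 1" and Ff: "F \<in> faces P" using F(2) by (auto simp: facets_def)
  have FY: "F \<in> ?Y" using flag_adj_mem_iff[OF X i(1) i', of F] F(1) rF i by simp
  have gF: "g F = F"
    using chain_eq[OF flag_chain[OF Y] _ FY, of "g F"] automorphism_rank[OF g(1) X F(1)] g(2) F(1)
    by blast
  have gT: "g T = T"
    using chain_eq[OF flag_chain[OF Y] _ TX(2), of "g T"] automorphism_rank[OF g(1) X TX(1)] g(2) TX(1)
    by blast
  have "g \<in> automorphisms (facet_section P F)"
    using automorphism_facet_section_iso[OF g(1) Ff] gF by (simp add: automorphisms_def)
  moreover have "g ` (X - {T}) = ?Y - {T}"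
    using inj_on_image_set_diff[OF automorphism_inj[OF g(1)], of X "{T}"] g(2) gT TX(1) flag_faces[OF X]
    by auto
  ultimately have "same_orbit (facet_section P F) (X - {T}) (?Y - {T})"
    unfolding same_orbit_def by blast
  then show False
    using chiral_facets[OF F(2)] sec
      flag_remove_greatest[OF F(2) T section_polytope[OF F(2)] X F(1)]
    unfolding chiral_def by blast
qed

section \<open>Counting orbits and identifying the two-orbit types\<close>

context
  assumes n: "3 \<le> n"
begin

text \<open>The flips at 0 and \<open>n - 1\<close> are commuting involutions, as their ranks differ
  by at least 2, so the four flags are closed under both. Every other flip has the effect of the
  flip at 0 on orbits, and induction along flips reaches all flags.\<close>

lemma four_representatives:
  assumes X: "X \<in> flags P" and Z: "Z \<in> flags P"
  shows "\<exists>R \<in> {X, flag_adj P 0 X, flag_adj P (n - 1) X, flag_adj P 0 (flag_adj P (n - 1) X)}.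
    same_orbit P R Z"
proof -
  let ?a = "flag_adj P 0" and ?b = "flag_adj P (n - 1)"
  let ?R = "{X, ?a X, ?b X, ?a (?b X)}"
  have fl: "?a Y \<in> flags P" "?b Y \<in> flags P" if "Y \<in> flags P" for Y
    using flag_adj_flag[OF that] n by auto
  have aa: "?a (?a Y) = Y" and bb: "?b (?b Y) = Y" and ba: "?b (?a Y) = ?a (?b Y)"
    if "Y \<in> flags P" for Y
    using flag_adj_invol[OF that] flag_adj_commute[OF that, of 0 "n - 1"] n by auto
  have R_flags: "?R \<subseteq> flags P" using X fl by simp
  show ?thesis
    using X Z
  proof (induction rule: flags_induct)
    case base
    then show ?case using same_orbit_refl by blast
  next
    case (step Z i)
    then obtain R where R: "R \<in> ?R" "same_orbit P R Z" by blast
    have Rf: "R \<in> flags P" using R R_flags by blast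
    have Ri: "same_orbit P (flag_adj P i R) (flag_adj P i Z)"
      using same_orbit_flag_adj[OF Rf step(2,3) R(2)] .
    show ?case
    proof (cases "i = n - 1")
      case True
      have "?b R \<in> ?R" using R(1) ba bb X fl by auto
      then show ?thesis using Ri True by blast
    next
      case False
      have "?a R \<in> ?R" using R(1) aa X fl by auto
      moreover have "same_orbit P (?a R) (flag_adj P i R)"
        using low_adjacent_same_orbit[OF Rf, of 0 i] step(2,3) n False by simp
      ultimately show ?thesis using Ri same_orbit_trans by blast
    qed
  qed
qed

text \<open>Since the flip at rank \<open>n - 1\<close> commutes with the flip at rank 0, its effect on the orbit of
  a single flag is the same for all flags.\<close>

lemma two_or_four_orbits:
  "(card (flag_orbits P) = 2 \<and>
      ((\<forall>Z \<in> flags P. same_orbit P Z (flag_adj P (n - 1) Z)) \<or>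
       (\<forall>Z \<in> flags P. \<not> same_orbit P Z (flag_adj P (n - 1) Z))))
    \<or> card (flag_orbits P) = 4"
proof -
  let ?a = "flag_adj P 0" and ?b = "flag_adj P (n - 1)"
  obtain X where X: "X \<in> flags P" using flags_nonempty by blast
  have fl: "?a Y \<in> flags P" "?b Y \<in> flags P" if "Y \<in> flags P" for Y
    using flag_adj_flag[OF that] n by auto
  have aa: "?a (?a Y) = Y" and ba: "?b (?a Y) = ?a (?b Y)"
    if "Y \<in> flags P" for Y
    using flag_adj_invol[OF that] flag_adj_commute[OF that, of 0 "n - 1"] n by auto
  have o: "same_orbit P Y Z \<longleftrightarrow> orbit_of Y = orbit_of Z" if "Y \<in> flags P" "Z \<in> flags P" for Y Z
    using orbit_of_eq_iff that by simp
  \<comment> \<open>\<open>na\<close> says that \<open>?a\<close> fixes no orbit; \<open>ca\<close>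
    and \<open>cb\<close> say that \<open>?a\<close> and \<open>?b\<close> are well defined on
    orbits.\<close>
  have na: "orbit_of Y \<noteq> orbit_of (?a Y)" if "Y \<in> flags P" for Y
    using low_adjacent_other_orbit[OF that, of 0] o fl that n by simp
  have ca: "orbit_of (?a Y) = orbit_of (?a Z)" and cb: "orbit_of (?b Y) = orbit_of (?b Z)"
    if "Y \<in> flags P" "Z \<in> flags P" "orbit_of Y = orbit_of Z" for Y Z
    using same_orbit_flag_adj[of Y 0 Z] same_orbit_flag_adj[of Y "n - 1" Z] that n
      o[OF that(1,2)] o[OF fl(1)[OF that(1)] fl(1)[OF that(2)]]
      o[OF fl(2)[OF that(1)] fl(2)[OF that(2)]] by simp_all
  have reps: "orbit_of Z \<in> {orbit_of X, orbit_of (?a X), orbit_of (?b X), orbit_of (?a (?b X))}"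
    if "Z \<in> flags P" for Z
    using four_representatives[OF X that] o X fl that by auto
  then have orbits: "flag_orbits P = {orbit_of X, orbit_of (?a X), orbit_of (?b X), orbit_of (?a (?b X))}"
    using X fl by (auto simp: flag_orbits_eq)
  note fls = X fl[OF X] fl[OF fl(2)[OF X]]
  \<comment> \<open>On the orbit of \<open>X\<close>, the flip \<open>?b\<close> acts like the
    identity, like \<open>?a\<close>, or like neither. The first two cases leave two orbits, the
    last gives four.\<close>
  consider "orbit_of (?b X) = orbit_of X" | "orbit_of (?b X) = orbit_of (?a X)"
    | "orbit_of (?b X) \<noteq> orbit_of X" "orbit_of (?b X) \<noteq> orbit_of (?a X)" by blast
  then show ?thesis
  proof cases
    case 1
    have ab: "orbit_of (?a (?b X)) = orbit_of (?a X)" using ca[OF _ _ 1] fls by blast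
    have "card (flag_orbits P) = 2" unfolding orbits using 1 ab na[OF X] by (simp add: insert_commute)
    moreover have "orbit_of Z = orbit_of (?b Z)" if Z: "Z \<in> flags P" for Z
    proof -
      consider "orbit_of Z = orbit_of X" | "orbit_of Z = orbit_of (?a X)"
        using reps[OF Z] 1 ab by auto
      then show ?thesis
      proof cases
        case 1
        then show ?thesis using cb[OF Z X] \<open>orbit_of (?b X) = orbit_of X\<close> by simp
      next
        case 2
        then show ?thesis using cb[OF Z fl(1)[OF X]] ba[OF X] ab by simp
      qed
    qed
    ultimately show ?thesis using o[OF _ fl(2)] by blast
  next
    case 2
    have ab: "orbit_of (?a (?b X)) = orbit_of X" using ca[OF _ _ 2] fls aa[OF X] by simp
    have "card (flag_orbits P) = 2" unfolding orbits using 2 ab na[OF X] by (simp add: insert_commute)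
    moreover have "orbit_of Z \<noteq> orbit_of (?b Z)" if Z: "Z \<in> flags P" for Z
    proof -
      consider "orbit_of Z = orbit_of X" | "orbit_of Z = orbit_of (?a X)"
        using reps[OF Z] 2 ab by auto
      then show ?thesis
      proof cases
        case 1
        then show ?thesis using cb[OF Z X] 2 na[OF X] by simp
      next
        case 2
        then show ?thesis using cb[OF Z fl(1)[OF X]] ba[OF X] ab na[OF X] by simp
      qed
    qed
    ultimately show ?thesis using o[OF _ fl(2)] by blast
  next
    case 3
    \<comment> \<open>Applying the involution \<open>?a\<close> to an equality here, or to the next
      one, would give a case already excluded.\<close>
    have "orbit_of (?a (?b X)) \<noteq> orbit_of (?a X)"
      using ca[of "?a (?b X)" "?a X"] aa 3(1) fls by metis
    moreover have "orbit_of (?a (?b X)) \<noteq> orbit_of X"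
      using ca[of "?a (?b X)" X] aa 3(2) fls by metis
    ultimately have "card (flag_orbits P) = 4"
      unfolding orbits using 3 na[OF X] na[OF fl(2)[OF X]] by (auto simp: card_insert_if)
    then show ?thesis by blast
  qed
qed

text \<open>Flips below rank \<open>n - 1\<close> always change the orbit. The flip at
  \<open>n - 1\<close> behaves alike on all flags: if it keeps orbits the class is
  \<open>{n - 1}\<close>, otherwise every adjacency changes the orbit.\<close>

lemma two_orbit_type:
  assumes c: "card (flag_orbits P) = 2"
  shows "chiral P n \<or> in_class_2 {n - 1} P n"
proof -
  have "finite (flag_orbits P)" using c by (metis card.infinite zero_neq_numeral)
  then have k: "k_orbit_polytope 2 P n"
    unfolding k_orbit_polytope_def using c abstract_polytope_axioms by simp
  have low: "\<not> same_orbit P Z (flag_adj P i Z)"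
    if "Z \<in> flags P" "0 \<le> i" "i \<le> n - 1" "i \<noteq> n - 1" for Z i
    using low_adjacent_other_orbit that by simp
  consider "\<forall>Z \<in> flags P. same_orbit P Z (flag_adj P (n - 1) Z)"
    | "\<forall>Z \<in> flags P. \<not> same_orbit P Z (flag_adj P (n - 1) Z)"
    using two_or_four_orbits c by auto
  then show ?thesis
  proof cases
    case 1
    then have "same_orbit P Z (flag_adj P i Z) \<longleftrightarrow> i = n - 1"
      if "Z \<in> flags P" "0 \<le> i" "i \<le> n - 1" for Z i
      using low[OF that] that(1) by blast
    then have "in_class_2 {n - 1} P n"
      unfolding in_class_2_def using k n by simp
    then show ?thesis by blast
  next
    case 2
    have "\<not> same_orbit P Y Z" if YZ: "Y \<in> flags P" "Z \<in> flags P" "adjacent Y Z" for Y Z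
    proof -
      obtain i where i: "0 \<le> i" "i \<le> n - 1" "Z = flag_adj P i Y"
        by (rule adjacent_flag_adj[OF YZ])
      then show ?thesis using 2 low[OF YZ(1) i(1,2)] YZ(1) by (cases "i = n - 1") auto
    qed
    then show ?thesis unfolding chiral_def using k by blast
  qed
qed

text \<open>A flag through \<open>F\<close> and its flip at 0 both contain \<open>F\<close> and
  represent the two orbits. Hence some flag through \<open>F\<close> is carried to a flag through
  \<open>G\<close>, and since ranks are preserved \<open>F\<close> goes to \<open>G\<close>.\<close>

lemma two_orbit_facets_isomorphic:
  assumes c: "card (flag_orbits P) = 2" and F: "F \<in> facets P n" and G: "G \<in> facets P n"
  shows "isomorphic (facet_section P F) (facet_section P G)"
proof -
  obtain T where T: "is_greatest_face P T" using greatest by blast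
  obtain X where X: "X \<in> flags P" "F \<in> X"
    using flag_through_facet[OF F T section_polytope[OF F]] by blast
  obtain Y where Y: "Y \<in> flags P" "G \<in> Y"
    using flag_through_facet[OF G T section_polytope[OF G]] by blast
  let ?X' = "flag_adj P 0 X"
  have X': "?X' \<in> flags P" "F \<in> ?X'"
    using flag_adj_flag[OF X(1), of 0] flag_adj_mem_iff[OF X(1), of 0 F] X(2) F n
    by (auto simp: facets_def)
  have "\<not> same_orbit P X ?X'" using low_adjacent_other_orbit[OF X(1), of 0] n by simp
  then have "card {orbit_of X, orbit_of ?X'} = 2" using orbit_of_eq_iff X X' by simp
  moreover have "{orbit_of X, orbit_of ?X'} \<subseteq> flag_orbits P"
    using X X' by (auto simp: flag_orbits_eq)
  moreover have "finite (flag_orbits P)" using c by (metis card.infinite zero_neq_numeral)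
  ultimately have "flag_orbits P = {orbit_of X, orbit_of ?X'}"
    using c by (metis card_subset_eq)
  moreover have "orbit_of Y \<in> flag_orbits P" using Y by (simp add: flag_orbits_eq)
  ultimately have "orbit_of X = orbit_of Y \<or> orbit_of ?X' = orbit_of Y" by auto
  then have "same_orbit P X Y \<or> same_orbit P ?X' Y"
    using orbit_of_eq_iff[OF X(1) Y(1)] orbit_of_eq_iff[OF X'(1) Y(1)] by simp
  then obtain Z where Z: "Z \<in> flags P" "F \<in> Z" "same_orbit P Z Y" using X X' by blast
  then obtain g where g: "g \<in> automorphisms P" "Y = g ` Z" unfolding same_orbit_def by blast
  have "g F = G"
    using chain_eq[OF flag_chain[OF Y(1)] _ Y(2), of "g F"] automorphism_rank[OF g(1) Z(1,2)]
      g(2) Z(2) F G by (auto simp: facets_def)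
  then show ?thesis
    using automorphism_facet_section_iso[OF g(1), of F] F
    unfolding isomorphic_def facets_def by auto
qed

end

end

theorem theorem3:
  fixes P :: "'a ranked_poset" and n :: nat
  assumes "abstract_polytope P (int n)"
    and "hereditary P (int n)"
    and "\<And>F. F \<in> facets P (int n) \<Longrightarrow> chiral (facet_section P F) (int n - 1)"
  shows "(k_orbit_polytope 2 P (int n) \<and>
           (chiral P (int n) \<or> in_class_2 {int n - 1} P (int n)) \<and>
           (\<forall>F \<in> facets P (int n). \<forall>G \<in> facets P (int n).
              isomorphic (facet_section P F) (facet_section P G)))
         \<or> k_orbit_polytope 4 P (int n)"
proof -
  interpret hereditary_chiral_facets P "int n"
    using assms by (simp add: hereditary_chiral_facets_def hereditary_chiral_facets_axioms_def)
  have n: "3 \<le> int n" by (rule rank_ge_3) simp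
  \<comment> \<open>\<open>card\<close> is 0 on infinite sets, so a nonzero count already yields the
    required finiteness.\<close>
  have k: "k_orbit_polytope k P (int n)" if "card (flag_orbits P) = k" "k \<noteq> 0" for k
    unfolding k_orbit_polytope_def using that assms(1) card.infinite by metis
  consider "card (flag_orbits P) = 2" | "card (flag_orbits P) = 4"
    using two_or_four_orbits[OF n] by blast
  then show ?thesis
  proof cases
    case 1
    then show ?thesis
      using k two_orbit_type[OF n 1] two_orbit_facets_isomorphic[OF n 1] by simp
  next
    case 2
    then show ?thesis using k by simp
  qed
qed

end
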